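(* Let $(w_n)_{n\ge 1}$ be a sequence of bicomplex numbers with $w_n\notin\mathcal{NC}$ for all $n$. Then the infinite product $\prod_{n=1}^{\infty}w_n$ converges absolutely if and only if the series $\sum_{n=1}^{\infty}(w_n-1)$ converges absolutely.
   Context: Bicomplex numbers: $\mathbb{T}=\{z_1+\mathbf{i}_2z_2 : z_1,z_2\in\mathbb{C}(\mathbf{i}_1)\}$, where $\mathbb{C}(\mathbf{i}_1)=\{x+\mathbf{i}_1y:x,y\in\mathbb{R}\}$ is a copy of $\mathbb{C}$, $\mathbf{i}_1^2=\mathbf{i}_2^2=-1$, and $\mathbf{i}_1\mathbf{i}_2=\mathbf{i}_2\mathbf{i}_1=\mathbf{j}$ (so $\mathbf{j}^2=1$). $\mathbb{T}$ is a commutative ring. The norm is $\|z_1+\mathbf{i}_2z_2\|=\sqrt{|z_1|^2+|z_2|^2}$. A series $\sum c_n$ of bicomplex numbers converges absolutely if $\sum\|c_n\|$ converges. Null cone: $\mathcal{NC}=\{z_1+\mathbf{i}_2z_2\in\mathbb{T}: z_1^2+z_2^2=0\}$, the set of singular (non-invertible) elements (including $0$). Absolute convergence of products: if $w_n\notin\mathcal{NC}$ for all $n$, the infinite product $\prod_{n=1}^{\infty}w_n$ is said to converge absolutely if the series $\sum_{n=1}^{\infty}\log w_n$ converges absolutely, where $\log$ is the principal branch of the bicomplex logarithm, defined next. Principal bicomplex logarithm: for $w=z_1+\mathbf{i}_2z_2\notin\mathcal{NC}$, let $|w|_{\mathbf{i}_1}=\sqrt{z_1^2+z_2^2}\in\mathbb{C}(\mathbf{i}_1)\setminus\{0\}$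 (principal complex square root), and let $\mathrm{Arg}_{\mathbf{i}_1}w=\Theta\in\mathbb{C}(\mathbf{i}_1)$ be the unique solution of $\cos\Theta=z_1/|w|_{\mathbf{i}_1}$, $\sin\Theta=z_2/|w|_{\mathbf{i}_1}$ with $-\pi<\mathrm{Re}\,\Theta\le\pi$. Then $$\log w=\log\big||w|_{\mathbf{i}_1}\big|+\mathbf{i}_1\,\mathrm{Arg}(|w|_{\mathbf{i}_1})+\mathbf{i}_2\,\mathrm{Arg}_{\mathbf{i}_1}w,$$ where $\mathrm{Arg}$ is the usual principal complex argument in $(-\pi,\pi]$ and $\log\big||w|_{\mathbf{i}_1}\big|$ is the real logarithm of the ordinary absolute value of the complex number $|w|_{\mathbf{i}_1}$. *)

theory Defs
  imports "HOL-Analysis.Analysis"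
begin

section \<open>The ring of bicomplex numbers\<close>

text \<open>\<open>Bicomplex z\<^sub>1 z\<^sub>2\<close> stands for \<open>z\<^sub>1 + \<i>\<^sub>2 z\<^sub>2\<close>; the type \<^typ>\<open>complex\<close>, with its imaginary
  unit, plays the role of \<open>\<complex>(\<i>\<^sub>1)\<close>.\<close>

datatype bicomplex = Bicomplex (bc1: complex) (bc2: complex)

lemma bicomplex_eq_iff: "v = w \<longleftrightarrow> bc1 v = bc1 w \<and> bc2 v = bc2 w"
  by (cases v; cases w) simp

instantiation bicomplex :: real_algebra_1
begin

definition "0 = Bicomplex 0 0"
definition "1 = Bicomplex 1 0"
definition "v + w = Bicomplex (bc1 v + bc1 w) (bc2 v + bc2 w)"
definition "- w = Bicomplex (- bc1 w) (- bc2 w)"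
definition "v - w = Bicomplex (bc1 v - bc1 w) (bc2 v - bc2 w)"
definition "v * w = Bicomplex (bc1 v * bc1 w - bc2 v * bc2 w) (bc1 v * bc2 w + bc2 v * bc1 w)"
definition "r *\<^sub>R w = Bicomplex (r *\<^sub>R bc1 w) (r *\<^sub>R bc2 w)"

lemmas bicomplex_ops = zero_bicomplex_def one_bicomplex_def plus_bicomplex_def
  uminus_bicomplex_def minus_bicomplex_def times_bicomplex_def scaleR_bicomplex_def

instance
  by standard (simp_all add: bicomplex_eq_iff bicomplex_ops algebra_simps)

end

instance bicomplex :: comm_ring_1
  by standard (simp_all add: bicomplex_eq_iff bicomplex_ops algebra_simps)

text \<open>The norm is the Euclidean one; it is not submultiplicative, so the type is not an instance
  of \<^class>\<open>real_normed_algebra\<close>.\<close>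

instantiation bicomplex :: real_normed_vector
begin

definition "norm w = sqrt ((cmod (bc1 w))\<^sup>2 + (cmod (bc2 w))\<^sup>2)"
definition "sgn (w :: bicomplex) = w /\<^sub>R norm w"
definition "dist (v :: bicomplex) w = norm (v - w)"
definition "uniformity = (INF e\<in>{0<..}. principal {(v :: bicomplex, w). dist v w < e})"
definition "open (U :: bicomplex set) \<longleftrightarrow>
  (\<forall>v\<in>U. eventually (\<lambda>(v', w). v' = v \<longrightarrow> w \<in> U) uniformity)"

lemma norm_bicomplex_eq_norm_Pair: "norm w = norm (bc1 w, bc2 w)"
  by (simp add: norm_bicomplex_def norm_Pair)

instance
proof
  fix v w :: bicomplex and r :: real
  show "norm w = 0 \<longleftrightarrow> w = 0"
    by (simp add: norm_bicomplex_eq_norm_Pair bicomplex_eq_iff zero_bicomplex_def prod_eq_iff)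
  show "norm (v + w) \<le> norm v + norm w"
    using norm_triangle_ineq[of "(bc1 v, bc2 v)" "(bc1 w, bc2 w)"]
    by (simp add: norm_bicomplex_eq_norm_Pair plus_bicomplex_def)
  show "norm (r *\<^sub>R w) = \<bar>r\<bar> * norm w"
    using norm_scaleR[of r "(bc1 w, bc2 w)"]
    by (simp add: norm_bicomplex_eq_norm_Pair scaleR_bicomplex_def)
qed (simp_all add: sgn_bicomplex_def dist_bicomplex_def uniformity_bicomplex_def open_bicomplex_def)

end

definition bc_of_complex :: "complex \<Rightarrow> bicomplex" where
  "bc_of_complex z = Bicomplex z 0"

definition bc_i1 :: bicomplex where "bc_i1 = Bicomplex \<i> 0"

definition bc_i2 :: bicomplex where "bc_i2 = Bicomplex 0 1"

lemma bicomplex_units: "bc_i1 * bc_i1 = -1" "bc_i2 * bc_i2 = -1"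
  by (simp_all add: bc_i1_def bc_i2_def bicomplex_eq_iff bicomplex_ops)

lemma Bicomplex_eq: "Bicomplex z1 z2 = bc_of_complex z1 + bc_i2 * bc_of_complex z2"
  by (simp add: bc_of_complex_def bc_i2_def bicomplex_ops)

definition null_cone :: "bicomplex set" where
  "null_cone = {w. (bc1 w)\<^sup>2 + (bc2 w)\<^sup>2 = 0}"

lemma null_cone_iff_not_unit: "w \<in> null_cone \<longleftrightarrow> \<not> w dvd 1"
proof
  assume w: "w \<in> null_cone"
  show "\<not> w dvd 1"
  proof
    assume "w dvd 1"
    then obtain v where "1 = w * v" by (auto elim: dvdE)
    then have *: "bc1 w * bc1 v - bc2 w * bc2 v = 1" "bc1 w * bc2 v + bc2 w * bc1 v = 0"
      by (simp_all add: bicomplex_eq_iff bicomplex_ops)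
    have "((bc1 w)\<^sup>2 + (bc2 w)\<^sup>2) * ((bc1 v)\<^sup>2 + (bc2 v)\<^sup>2) =
        (bc1 w * bc1 v - bc2 w * bc2 v)\<^sup>2 + (bc1 w * bc2 v + bc2 w * bc1 v)\<^sup>2"
      by (simp add: power2_eq_square algebra_simps)
    with w * show False by (simp add: null_cone_def)
  qed
next
  assume w: "\<not> w dvd 1"
  show "w \<in> null_cone"
  proof (rule ccontr)
    assume "w \<notin> null_cone"
    then have nz: "(bc1 w)\<^sup>2 + (bc2 w)\<^sup>2 \<noteq> 0" by (simp add: null_cone_def)
    let ?N = "(bc1 w)\<^sup>2 + (bc2 w)\<^sup>2"
    have "bc1 w * (bc1 w / ?N) - bc2 w * (- bc2 w / ?N) = ?N / ?N"
      by (simp only: power2_eq_square add_divide_distrib times_divide_eq_right) simp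
    also have "\<dots> = 1" using nz by simp
    finally have "1 = w * Bicomplex (bc1 w / ?N) (- bc2 w / ?N)"
      by (simp add: bicomplex_eq_iff bicomplex_ops)
    with w show False by (metis dvdI)
  qed
qed

section \<open>The principal logarithm\<close>

definition bc_modulus :: "bicomplex \<Rightarrow> complex" where
  "bc_modulus w = csqrt ((bc1 w)\<^sup>2 + (bc2 w)\<^sup>2)"

definition bc_Arg :: "bicomplex \<Rightarrow> complex" where
  "bc_Arg w = (THE \<Theta>. cos \<Theta> = bc1 w / bc_modulus w \<and> sin \<Theta> = bc2 w / bc_modulus w \<and>
     - pi < Re \<Theta> \<and> Re \<Theta> \<le> pi)"

lemma bc_Arg_ex1:
  assumes "w \<notin> null_cone"
  shows "\<exists>!\<Theta>. cos \<Theta> = bc1 w / bc_modulus w \<and> sin \<Theta> = bc2 w / bc_modulus w \<and>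
     - pi < Re \<Theta> \<and> Re \<Theta> \<le> pi"
proof -
  define c s where "c = bc1 w / bc_modulus w" and "s = bc2 w / bc_modulus w"
  have m2: "(bc_modulus w)\<^sup>2 = (bc1 w)\<^sup>2 + (bc2 w)\<^sup>2"
    by (simp add: bc_modulus_def)
  have "c\<^sup>2 + s\<^sup>2 = ((bc1 w)\<^sup>2 + (bc2 w)\<^sup>2) / (bc_modulus w)\<^sup>2"
    by (simp add: c_def s_def power_divide add_divide_distrib)
  also have "\<dots> = 1"
    using assms by (simp add: m2 null_cone_def)
  finally have cs: "c\<^sup>2 + s\<^sup>2 = 1" .
  have prod: "(c + \<i> * s) * (c - \<i> * s) = 1"
    using cs by (simp add: algebra_simps power2_eq_square)
  then have nz: "c + \<i> * s \<noteq> 0" by auto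
  have inv: "inverse (c + \<i> * s) = c - \<i> * s"
    using prod by (rule inverse_unique)
  have char: "cos \<Theta> = c \<and> sin \<Theta> = s \<longleftrightarrow> exp (\<i> * \<Theta>) = c + \<i> * s" for \<Theta>
  proof
    assume "cos \<Theta> = c \<and> sin \<Theta> = s"
    then show "exp (\<i> * \<Theta>) = c + \<i> * s" by (simp add: exp_Euler)
  next
    assume e: "exp (\<i> * \<Theta>) = c + \<i> * s"
    then have "exp (- (\<i> * \<Theta>)) = c - \<i> * s"
      by (simp add: exp_minus inv)
    with e show "cos \<Theta> = c \<and> sin \<Theta> = s"
      by (simp add: cos_exp_eq sin_exp_eq)
  qed
  have "\<exists>!\<Theta>. exp (\<i> * \<Theta>) = c + \<i> * s \<and> - pi < Re \<Theta> \<and> Re \<Theta> \<le> pi"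
  proof (rule ex1I[of _ "- (\<i> * Ln (c + \<i> * s))"])
    have "\<i> * - (\<i> * Ln (c + \<i> * s)) = Ln (c + \<i> * s)"
      by (simp add: mult.assoc[symmetric])
    then show "exp (\<i> * - (\<i> * Ln (c + \<i> * s))) = c + \<i> * s \<and>
        - pi < Re (- (\<i> * Ln (c + \<i> * s))) \<and> Re (- (\<i> * Ln (c + \<i> * s))) \<le> pi"
      using nz mpi_less_Im_Ln[OF nz] Im_Ln_le_pi[OF nz] by simp
  next
    fix \<Theta>
    assume *: "exp (\<i> * \<Theta>) = c + \<i> * s \<and> - pi < Re \<Theta> \<and> Re \<Theta> \<le> pi"
    then have "Ln (exp (\<i> * \<Theta>)) = \<i> * \<Theta>" by (intro Ln_exp) auto
    with * have "Ln (c + \<i> * s) = \<i> * \<Theta>" by simp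
    then show "\<Theta> = - (\<i> * Ln (c + \<i> * s))"
      by (simp add: mult.assoc[symmetric])
  qed
  then show ?thesis
    unfolding c_def[symmetric] s_def[symmetric] conj_assoc[symmetric] char .
qed

definition bc_Log :: "bicomplex \<Rightarrow> bicomplex" where
  "bc_Log w = of_real (ln (cmod (bc_modulus w))) + bc_i1 * of_real (Arg (bc_modulus w)) +
     bc_i2 * bc_of_complex (bc_Arg w)"

section \<open>Absolute convergence\<close>

text \<open>Sequences are indexed from \<open>1\<close>; the value at \<open>0\<close> is ignored.\<close>

definition bc_series_converges_absolutely :: "(nat \<Rightarrow> bicomplex) \<Rightarrow> bool" where
  "bc_series_converges_absolutely c \<longleftrightarrow> summable (\<lambda>n. norm (c (Suc n)))"

text \<open>Only meaningful if \<open>w n \<notin> null_cone\<close> for all \<open>n \<ge> 1\<close>. The library's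
  \<^const>\<open>abs_convergent_prod\<close> is defined by the convergence of \<open>\<Prod>n. 1 + norm (w n - 1)\<close> instead.\<close>

definition bc_prod_converges_absolutely :: "(nat \<Rightarrow> bicomplex) \<Rightarrow> bool" where
  "bc_prod_converges_absolutely w \<longleftrightarrow> bc_series_converges_absolutely (\<lambda>n. bc_Log (w n))"

end

theory Submission
  imports Defs
begin

text \<open>The two ring homomorphisms \<open>z\<^sub>1 + \<i>\<^sub>2 z\<^sub>2 \<mapsto> z\<^sub>1 \<plusminus> \<i>\<^sub>1 z\<^sub>2\<close> identify the bicomplex numbers
  with \<open>\<complex> \<times> \<complex>\<close>, up to equivalence of norms, so absolute convergence may be tested on their images.
  Under them \<open>exp (log w) = w\<close> becomes the complex exponential in each coordinate, and for \<open>w\<close> near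
  \<open>1\<close> the principal bicomplex logarithm becomes the principal complex one. As \<open>exp z - 1\<close> and
  \<open>Ln (1 + z)\<close> are both differentiable and vanish at \<open>0\<close>, they preserve absolute summability.\<close>

definition bc_plus :: "bicomplex \<Rightarrow> complex" where
  "bc_plus w = bc1 w + \<i> * bc2 w"

definition bc_minus :: "bicomplex \<Rightarrow> complex" where
  "bc_minus w = bc1 w - \<i> * bc2 w"

lemma bc_plus_diff_1: "bc_plus (w - 1) = bc_plus w - 1"
  and bc_minus_diff_1: "bc_minus (w - 1) = bc_minus w - 1"
  by (simp_all add: bc_plus_def bc_minus_def bicomplex_ops)

lemma bc_plus_mult_bc_minus: "bc_plus w * bc_minus w = (bc1 w)\<^sup>2 + (bc2 w)\<^sup>2"
  by (simp add: bc_plus_def bc_minus_def algebra_simps power2_eq_square)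

lemma norm_bc1_le: "norm (bc1 w) \<le> norm w"
  and norm_bc2_le: "norm (bc2 w) \<le> norm w"
  by (simp_all add: norm_bicomplex_def)

lemma norm_bc_plus_le: "norm (bc_plus w) \<le> 2 * norm w"
  using norm_triangle_ineq[of "bc1 w" "\<i> * bc2 w"] norm_bc1_le[of w] norm_bc2_le[of w]
  by (simp add: bc_plus_def norm_mult)

lemma norm_bc_minus_le: "norm (bc_minus w) \<le> 2 * norm w"
  using norm_triangle_ineq4[of "bc1 w" "\<i> * bc2 w"] norm_bc1_le[of w] norm_bc2_le[of w]
  by (simp add: bc_minus_def norm_mult)

lemma norm_le_bc_plus_bc_minus: "norm w \<le> norm (bc_plus w) + norm (bc_minus w)"
proof -
  have "2 * bc1 w = bc_plus w + bc_minus w" "2 * \<i> * bc2 w = bc_plus w - bc_minus w"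
    by (simp_all add: bc_plus_def bc_minus_def)
  then have "norm (2 * bc1 w) \<le> norm (bc_plus w) + norm (bc_minus w)"
    "norm (2 * \<i> * bc2 w) \<le> norm (bc_plus w) + norm (bc_minus w)"
    by (simp_all add: norm_triangle_ineq norm_triangle_ineq4)
  moreover have "norm w \<le> norm (bc1 w) + norm (bc2 w)"
    by (simp add: norm_bicomplex_def sqrt_sum_squares_le_sum)
  ultimately show ?thesis
    by (simp add: norm_mult)
qed

lemma summable_norm_bicomplex_iff:
  "summable (\<lambda>n. norm (c n)) \<longleftrightarrow>
     summable (\<lambda>n. norm (bc_plus (c n))) \<and> summable (\<lambda>n. norm (bc_minus (c n)))"
proof
  assume "summable (\<lambda>n. norm (c n))"
  then have *: "summable (\<lambda>n. 2 * norm (c n))"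
    by (rule summable_mult)
  show "summable (\<lambda>n. norm (bc_plus (c n))) \<and> summable (\<lambda>n. norm (bc_minus (c n)))"
    by (intro conjI summable_comparison_test'[OF *, of 0])
      (simp_all add: norm_bc_plus_le norm_bc_minus_le)
next
  assume "summable (\<lambda>n. norm (bc_plus (c n))) \<and> summable (\<lambda>n. norm (bc_minus (c n)))"
  then have *: "summable (\<lambda>n. norm (bc_plus (c n)) + norm (bc_minus (c n)))"
    by (simp add: summable_add)
  show "summable (\<lambda>n. norm (c n))"
    by (rule summable_comparison_test'[OF *, of 0]) (simp add: norm_le_bc_plus_bc_minus)
qed

text \<open>The quotient \<open>g z / z\<close> tends to \<open>D\<close>, so
  \<open>norm (g z)\<close> is at most \<open>(norm D + 1) * norm z\<close> near 0. As
  \<open>f\<close> tends to 0, comparison with \<open>f\<close> applies.\<close>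

lemma summable_norm_compose_differentiable:
  fixes f :: "nat \<Rightarrow> 'a::real_normed_field"
  assumes f: "summable (\<lambda>n. norm (f n))"
    and g: "(g has_field_derivative D) (at 0)" "g 0 = 0"
  shows "summable (\<lambda>n. norm (g (f n)))"
proof -
  have "((\<lambda>z. g z / z) \<longlongrightarrow> D) (at 0)"
    using g by (simp add: DERIV_def)
  then have "((\<lambda>z. norm (g z / z)) \<longlongrightarrow> norm D) (at 0)"
    by (rule tendsto_norm)
  then have "\<forall>\<^sub>F z in at 0. norm (g z / z) < norm D + 1"
    by (rule order_tendstoD) simp
  then have "\<forall>\<^sub>F z in at 0. norm (g z) \<le> (norm D + 1) * norm z"
    unfolding eventually_at_filter
    by eventually_elim (auto simp: norm_divide divide_simps mult.commute)
  \<comment> \<open>The point 0 has to be included, since some \<open>f n\<close> may vanish; there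
    the bound is \<open>g 0 = 0\<close>.\<close>
  then have "\<forall>\<^sub>F z in nhds 0. norm (g z) \<le> (norm D + 1) * norm z"
    unfolding eventually_at_filter by eventually_elim (use g(2) in auto)
  moreover have "f \<longlonglongrightarrow> 0"
    using f by (rule tendsto_norm_zero_cancel[OF summable_LIMSEQ_zero])
  ultimately have "\<forall>\<^sub>F n in sequentially. norm (g (f n)) \<le> (norm D + 1) * norm (f n)"
    unfolding filterlim_iff by blast
  then show ?thesis
    by (intro summable_comparison_test_ev[OF _ summable_mult[OF f]]) simp
qed

lemma bc_modulus_nonzero: "w \<notin> null_cone \<Longrightarrow> bc_modulus w \<noteq> 0"
  by (simp add: bc_modulus_def null_cone_def)

text \<open>The real logarithm and the \<open>Arg\<close> in \<open>bc_Log\<close> are the real and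
  imaginary parts of \<open>Ln (bc_modulus w)\<close>.\<close>

lemma bc_Log_eq:
  assumes "w \<notin> null_cone"
  shows "bc_Log w = Bicomplex (Ln (bc_modulus w)) (bc_Arg w)"
proof -
  have "Ln (bc_modulus w) = of_real (ln (cmod (bc_modulus w))) + \<i> * of_real (Arg (bc_modulus w))"
    using bc_modulus_nonzero[OF assms] by (simp add: complex_eq_iff Arg_eq_Im_Ln)
  then show ?thesis
    by (simp add: bc_Log_def bc_i1_def bc_i2_def bc_of_complex_def of_real_def bicomplex_ops)
qed

text \<open>Branches do not matter here: Euler's formula and the equations for the cosine and sine
  of \<open>bc_Arg w\<close> suffice, so no closeness to 1 is required.\<close>

lemma
  assumes "w \<notin> null_cone"
  shows exp_bc_plus_Log: "exp (bc_plus (bc_Log w)) = bc_plus w"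
    and exp_bc_minus_Log: "exp (bc_minus (bc_Log w)) = bc_minus w"
proof -
  let ?m = "bc_modulus w" and ?t = "bc_Arg w"
  have m: "?m \<noteq> 0"
    using assms by (rule bc_modulus_nonzero)
  have t: "cos ?t = bc1 w / ?m" "sin ?t = bc2 w / ?m"
    using theI'[OF bc_Arg_ex1[OF assms], folded bc_Arg_def] by auto
  have "exp (Ln ?m + \<i> * ?t) = ?m * (cos ?t + \<i> * sin ?t)"
    using m by (simp add: exp_add exp_Euler)
  also have "\<dots> = bc_plus w"
    using m by (simp add: t bc_plus_def field_simps)
  finally show "exp (bc_plus (bc_Log w)) = bc_plus w"
    by (simp add: bc_Log_eq assms bc_plus_def)
  have "exp (Ln ?m - \<i> * ?t) = ?m * (cos ?t - \<i> * sin ?t)"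
    using m exp_Euler[of "- ?t"] exp_add[of "Ln ?m" "- (\<i> * ?t)"] by simp
  also have "\<dots> = bc_minus w"
    using m by (simp add: t bc_minus_def field_simps)
  finally show "exp (bc_minus (bc_Log w)) = bc_minus w"
    by (simp add: bc_Log_eq assms bc_minus_def)
qed

text \<open>In the right half-plane both logarithms have imaginary part below \<open>pi / 2\<close>
  in absolute value. Half their sum and half their difference then stay in the principal ranges, and
  no multiple of \<open>2 * pi\<close> intervenes.\<close>

lemma
  assumes pos: "Re (bc_plus w) > 0" "Re (bc_minus w) > 0"
  shows bc_plus_Log: "bc_plus (bc_Log w) = Ln (bc_plus w)"
    and bc_minus_Log: "bc_minus (bc_Log w) = Ln (bc_minus w)"
proof -
  define a b where "a = Ln (bc_plus w)" and "b = Ln (bc_minus w)"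
  have nz: "bc_plus w \<noteq> 0" "bc_minus w \<noteq> 0"
    using pos by auto
  then have w: "w \<notin> null_cone"
    by (simp add: null_cone_def flip: bc_plus_mult_bc_minus)
  have im: "\<bar>Im a\<bar> < pi / 2" "\<bar>Im b\<bar> < pi / 2"
    unfolding a_def b_def by (intro Re_Ln_pos_lt_imp pos)+
  \<comment> \<open>The imaginary part of \<open>a + b\<close> lies strictly between
    \<open>- pi\<close> and \<open>pi\<close>, so \<open>Ln\<close> is additive here.\<close>
  have "Ln (bc_plus w * bc_minus w) = a + b"
    using nz im by (simp add: a_def b_def Ln_times_simple)
  then have m: "bc_modulus w = exp ((a + b) / 2)"
    using nz by (simp add: bc_modulus_def csqrt_exp_Ln flip: bc_plus_mult_bc_minus)
  have Ln_m: "Ln (bc_modulus w) = (a + b) / 2"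
    using im by (simp add: m)
  \<comment> \<open>This is the solution of \<open>a = Ln m + \<i> * t\<close> and
    \<open>b = Ln m - \<i> * t\<close> for \<open>m = bc_modulus w\<close>, hence the candidate for
    \<open>bc_Arg w\<close>.\<close>
  define t where "t = - (\<i> * ((a - b) / 2))"
  have it: "\<i> * t = (a - b) / 2"
    by (simp add: t_def complex_eq_iff field_simps)
  have "a - (a + b) / 2 = (a - b) / 2" "b - (a + b) / 2 = - ((a - b) / 2)"
    by (simp_all add: field_simps)
  then have "exp (\<i> * t) = exp a / bc_modulus w" "exp (- (\<i> * t)) = exp b / bc_modulus w"
    unfolding it m exp_diff[symmetric] by (simp_all only:)
  then have t: "exp (\<i> * t) = bc_plus w / bc_modulus w"
      "exp (- (\<i> * t)) = bc_minus w / bc_modulus w"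
    using nz by (simp_all add: a_def b_def)
  have "cos t = bc1 w / bc_modulus w"
    unfolding cos_exp_eq t by (simp add: bc_plus_def bc_minus_def flip: add_divide_distrib)
  moreover have "sin t = bc2 w / bc_modulus w"
    unfolding sin_exp_eq t by (simp add: bc_plus_def bc_minus_def flip: diff_divide_distrib)
  \<comment> \<open>The bounds on \<open>Im a\<close> and \<open>Im b\<close> put \<open>t\<close>
    in the strip where the angle is unique.\<close>
  moreover have "Re t = (Im a - Im b) / 2"
    by (simp add: t_def field_simps)
  then have "- pi < Re t \<and> Re t \<le> pi"
    using im[unfolded abs_less_iff] by simp
  ultimately have "bc_Arg w = t"
    unfolding bc_Arg_def by (intro the1_equality[OF bc_Arg_ex1[OF w]]) simp
  then have "bc_plus (bc_Log w) = (a + b) / 2 + (a - b) / 2"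
    "bc_minus (bc_Log w) = (a + b) / 2 - (a - b) / 2"
    by (simp_all add: bc_Log_eq w Ln_m it bc_plus_def[of "Bicomplex _ _"]
        bc_minus_def[of "Bicomplex _ _"])
  then show "bc_plus (bc_Log w) = Ln (bc_plus w)" "bc_minus (bc_Log w) = Ln (bc_minus w)"
    by (simp_all add: a_def b_def field_simps)
qed

text \<open>The terms tend to 1, hence eventually enter the half-plane where
  \<open>bc_plus_Log\<close> and \<open>bc_minus_Log\<close> apply.\<close>

lemma eventually_Re_pos_if_summable:
  assumes "summable (\<lambda>n. norm (z n - 1 :: complex))"
  shows "\<forall>\<^sub>F n in sequentially. Re (z n) > 0"
proof -
  have "(\<lambda>n. z n - 1) \<longlonglongrightarrow> 0"
    using assms by (rule tendsto_norm_zero_cancel[OF summable_LIMSEQ_zero])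
  then have "(\<lambda>n. Re (z n)) \<longlonglongrightarrow> Re 1"
    by (intro tendsto_Re) (simp add: LIM_zero_iff)
  then show ?thesis
    by (rule order_tendstoD) simp
qed

lemma summable_norm_exp_diff_1:
  fixes f :: "nat \<Rightarrow> complex"
  assumes "summable (\<lambda>n. norm (f n))"
  shows "summable (\<lambda>n. norm (exp (f n) - 1))"
  by (rule summable_norm_compose_differentiable[OF assms]) (auto intro!: derivative_eq_intros)

text \<open>The point 1 is off the branch cut, so \<open>Ln (1 + z)\<close> is differentiable at
  0.\<close>

lemma summable_norm_Ln:
  assumes "summable (\<lambda>n. norm (z n - 1))"
  shows "summable (\<lambda>n. norm (Ln (z n)))"
proof -
  have "((\<lambda>z. Ln (1 + z)) has_field_derivative 1) (at 0)"
    by (auto intro!: derivative_eq_intros)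
  from summable_norm_compose_differentiable[OF assms this] show ?thesis
    by simp
qed

theorem corollary1:
  fixes w :: "nat \<Rightarrow> bicomplex"
  assumes "\<And>n. n \<ge> 1 \<Longrightarrow> w n \<notin> null_cone"
  shows "bc_prod_converges_absolutely w \<longleftrightarrow> bc_series_converges_absolutely (\<lambda>n. w n - 1)"
proof -
  \<comment> \<open>After the shift, the hypothesis on indices from 1 on covers every index.\<close>
  define v where "v n = w (Suc n)" for n
  have v: "v n \<notin> null_cone" for n
    using assms by (simp add: v_def)
  have "summable (\<lambda>n. norm (bc_Log (v n))) \<longleftrightarrow> summable (\<lambda>n. norm (v n - 1))"
  proof
    assume "summable (\<lambda>n. norm (bc_Log (v n)))"
    then have "summable (\<lambda>n. norm (bc_plus (bc_Log (v n))))"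
      "summable (\<lambda>n. norm (bc_minus (bc_Log (v n))))"
      by (simp_all add: summable_norm_bicomplex_iff)
    from this[THEN summable_norm_exp_diff_1] show "summable (\<lambda>n. norm (v n - 1))"
      by (simp add: exp_bc_plus_Log exp_bc_minus_Log v summable_norm_bicomplex_iff
          bc_plus_diff_1 bc_minus_diff_1)
  next
    assume "summable (\<lambda>n. norm (v n - 1))"
    then have s: "summable (\<lambda>n. norm (bc_plus (v n) - 1))" "summable (\<lambda>n. norm (bc_minus (v n) - 1))"
      by (simp_all add: summable_norm_bicomplex_iff bc_plus_diff_1 bc_minus_diff_1)
    note pos = s[THEN eventually_Re_pos_if_summable]
    \<comment> \<open>The finitely many terms outside the half-plane, where the logarithms may
      differ, do not affect summability.\<close>
    from pos have p: "\<forall>\<^sub>F n in sequentially. norm (bc_plus (bc_Log (v n))) = norm (Ln (bc_plus (v n)))"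
      by eventually_elim (simp add: bc_plus_Log)
    from pos have "\<forall>\<^sub>F n in sequentially. norm (bc_minus (bc_Log (v n))) = norm (Ln (bc_minus (v n)))"
      by eventually_elim (simp add: bc_minus_Log)
    from p[THEN summable_cong] this[THEN summable_cong] show "summable (\<lambda>n. norm (bc_Log (v n)))"
      using s[THEN summable_norm_Ln] by (simp add: summable_norm_bicomplex_iff)
  qed
  then show ?thesis
    by (simp add: bc_prod_converges_absolutely_def bc_series_converges_absolutely_def v_def)
qed

end
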